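(* The maximum internal amplification factors of the explicit Euler extrapolation methods over their absolute stability regions satisfy $$\mathcal{M}^{\mathrm{EE}}_2(\mathcal{S}_2)\le\frac{13e^2}{10\sqrt\pi}<5.42,$$ while for any integer $p\ge3$ $$\mathcal{M}^{\mathrm{EE}}_p(\mathcal{S}_p)\le\frac{\left(\frac{2.6}{W(1/e)}\right)^p}{5.2\,\pi\sqrt{p-1}}<\frac{9.34^p}{5.2\,\pi\sqrt{p-1}}.$$
   Context: Explicit Euler (EE) extrapolation of order $p\ge2$ on the test equation $U'=\lambda U$, with $z=\tau\lambda\in\mathbb{C}$ and internal perturbations: given $U_n$ and residuals $\tilde r_{m,j}\in\mathbb{C}$ ($1\le m\le p$, $1\le j\le m$), set $$\widetilde Y_{m,0}=U_n,\qquad \widetilde Y_{m,j}=\Big(1+\frac zm\Big)\widetilde Y_{m,j-1}+\tilde r_{m,j}\ (1\le j\le m),\qquad T_{m,1}=\widetilde Y_{m,m},$$ $$T_{j,k}=T_{j,k-1}+\frac{T_{j,k-1}-T_{j-1,k-1}}{\frac{j}{j-k+1}-1}\quad(2\le k\le j\le p),\qquad U_{n+1}=T_{p,p}.$$ Then $U_{n+1}=P(z)U_n+\sum_{m=1}^p\sum_{\ell=1}^mQ^{\mathrm{EE}}_{p,m,\ell}(z)\,\tilde r_{m,\ell}$, which defines the internal stability polynomials $Q^{\mathrm{EE}}_{p,m,\ell}$. For $\mathcal{S}\subset\mathbb{C}$, $$\mathcal{M}^{\mathrm{EE}}_p(\mathcal{S}):=\max_{1\le m\le p}\max_{1\le\ell\le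 m}\sup_{z\in\mathcal{S}}|Q^{\mathrm{EE}}_{p,m,\ell}(z)|.$$ The absolute stability region of the method is $\mathcal{S}_p=\{z\in\mathbb{C}:|\sum_{k=0}^pz^k/k!|\le1\}$. $W$ is the Lambert function: for $x\ge-1/e$, $W(x)\ge-1$ is the unique number with $W(x)e^{W(x)}=x$. *)

theory Defs
  imports "HOL-Analysis.Analysis" "HOL-Computational_Algebra.Polynomial"
begin

text \<open>
  Residuals are given as a function \<open>r\<close> with \<open>r m j\<close> the residual of the \<open>j\<close>-th of the \<open>m\<close>
  Euler substeps; \<open>U\<close> is the current value \<open>U\<^sub>n\<close>, and \<open>z\<close> is the step size times \<open>\<lambda>\<close>.
\<close>

fun ee_stage :: "complex \<Rightarrow> complex \<Rightarrow> (nat \<Rightarrow> nat \<Rightarrow> complex) \<Rightarrow> nat \<Rightarrow> nat \<Rightarrow> complex" where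
  "ee_stage z U r m 0 = U"
| "ee_stage z U r m (Suc j) = (1 + z / of_nat m) * ee_stage z U r m j + r m (Suc j)"

text \<open>
  The Aitken--Neville tableau \<open>T\<^sub>j\<^sub>,\<^sub>k\<close>, meaningful for \<open>1 \<le> k \<le> j\<close>; the subtractions below
  do not truncate in that range.
\<close>

fun ee_tableau :: "complex \<Rightarrow> complex \<Rightarrow> (nat \<Rightarrow> nat \<Rightarrow> complex) \<Rightarrow> nat \<Rightarrow> nat \<Rightarrow> complex" where
  "ee_tableau z U r j k =
    (if k \<le> 1 then ee_stage z U r j j
     else ee_tableau z U r j (k - 1) +
       (ee_tableau z U r j (k - 1) - ee_tableau z U r (j - 1) (k - 1)) /
         (of_nat j / of_nat (j - k + 1) - 1))"

declare ee_tableau.simps [simp del]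

definition ee_step :: "nat \<Rightarrow> complex \<Rightarrow> complex \<Rightarrow> (nat \<Rightarrow> nat \<Rightarrow> complex) \<Rightarrow> complex" where
  "ee_step p z U r = ee_tableau z U r p p"

definition ee_expansion :: "nat \<Rightarrow> complex poly \<Rightarrow> (nat \<Rightarrow> nat \<Rightarrow> complex poly) \<Rightarrow> bool" where
  "ee_expansion p P Q \<longleftrightarrow>
    (\<forall>z U r. ee_step p z U r =
       poly P z * U + (\<Sum>m=1..p. \<Sum>l=1..m. poly (Q m l) z * r m l))"

text \<open>
  The internal stability polynomials are the coefficients of the residuals in the expansion.
  They are well defined for \<open>1 \<le> l \<le> m \<le> p\<close>: see \<open>ee_Q_ex1\<close> and \<open>ee_expansion_ee_Q\<close> below.
\<close>

definition ee_Q :: "nat \<Rightarrow> nat \<Rightarrow> nat \<Rightarrow> complex poly" where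
  "ee_Q p m l = (THE q. \<exists>P Q. ee_expansion p P Q \<and> Q m l = q)"

text \<open>The supremum is taken in \<^typ>\<open>ereal\<close>, so that it is \<open>\<infinity>\<close> when a polynomial is unbounded on \<open>S\<close>.\<close>

definition ee_max_amplification :: "nat \<Rightarrow> complex set \<Rightarrow> ereal" where
  "ee_max_amplification p S =
    (MAX m\<in>{1..p}. MAX l\<in>{1..m}. SUP z\<in>S. ereal (cmod (poly (ee_Q p m l) z)))"

definition ee_stability_region :: "nat \<Rightarrow> complex set" where
  "ee_stability_region p = {z. cmod (\<Sum>k=0..p. z ^ k / fact k) \<le> 1}"

text \<open>Principal branch; meaningful for \<open>x \<ge> - 1 / e\<close>, see \<open>lambert_W_ex1\<close>.\<close>

definition lambert_W :: "real \<Rightarrow> real" where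
  "lambert_W x = (THE w. w \<ge> -1 \<and> w * exp w = x)"

definition residual_linear ::
    "nat \<Rightarrow> (complex \<Rightarrow> complex \<Rightarrow> (nat \<Rightarrow> nat \<Rightarrow> complex) \<Rightarrow> complex) \<Rightarrow> bool" where
  "residual_linear p f \<longleftrightarrow>
    (\<exists>P Q. \<forall>z U r. f z U r =
       poly P z * U + (\<Sum>m=1..p. \<Sum>l=1..m. poly (Q m l) z * r m l))"

lemma residual_linear_add:
  assumes "residual_linear p f" "residual_linear p g"
  shows "residual_linear p (\<lambda>z U r. f z U r + g z U r)"
proof -
  obtain P Q P' Q' where
    "\<And>z U r. f z U r = poly P z * U + (\<Sum>m=1..p. \<Sum>l=1..m. poly (Q m l) z * r m l)"
    "\<And>z U r. g z U r = poly P' z * U + (\<Sum>m=1..p. \<Sum>l=1..m. poly (Q' m l) z * r m l)"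
    using assms unfolding residual_linear_def by blast
  then show ?thesis
    unfolding residual_linear_def
    by (intro exI[of _ "P + P'"] exI[of _ "\<lambda>m l. Q m l + Q' m l"])
       (simp add: sum.distrib algebra_simps)
qed

lemma residual_linear_mult:
  assumes "residual_linear p f"
  shows "residual_linear p (\<lambda>z U r. poly c z * f z U r)"
proof -
  obtain P Q where
    "\<And>z U r. f z U r = poly P z * U + (\<Sum>m=1..p. \<Sum>l=1..m. poly (Q m l) z * r m l)"
    using assms unfolding residual_linear_def by blast
  then show ?thesis
    unfolding residual_linear_def
    by (intro exI[of _ "c * P"] exI[of _ "\<lambda>m l. c * Q m l"])
       (simp add: sum_distrib_left algebra_simps)
qed

lemma residual_linear_initial: "residual_linear p (\<lambda>z U r. U)"
  unfolding residual_linear_def by (intro exI[of _ 1] exI[of _ "\<lambda>m l. 0"]) simp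

lemma sum_unit_residual:
  fixes c :: "nat \<Rightarrow> nat \<Rightarrow> complex"
  assumes "1 \<le> l" "l \<le> m" "m \<le> p"
  shows "(\<Sum>m'=1..p. \<Sum>l'=1..m'. c m' l' * (if m' = m \<and> l' = l then 1 else 0)) = c m l"
proof -
  have "(\<Sum>l'=1..m'. c m' l' * (if m' = m \<and> l' = l then 1 else 0)) =
          (if m' = m then c m l else 0)" for m'
    using assms by (cases "m' = m") (simp_all add: if_distrib sum.delta cong: if_cong)
  then show ?thesis using assms by (simp add: sum.delta)
qed

lemma residual_linear_residual:
  assumes "1 \<le> l" "l \<le> m" "m \<le> p"
  shows "residual_linear p (\<lambda>z U r. r m l)"
proof -
  have "(\<Sum>m'=1..p. \<Sum>l'=1..m'. poly (if m' = m \<and> l' = l then 1 else 0) z * r m' l') = r m l"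
    for z :: complex and r
  proof -
    have "(\<Sum>m'=1..p. \<Sum>l'=1..m'. poly (if m' = m \<and> l' = l then 1 else 0) z * r m' l') =
        (\<Sum>m'=1..p. \<Sum>l'=1..m'. r m' l' * (if m' = m \<and> l' = l then 1 else 0))"
      by (intro sum.cong refl) auto
    also have "\<dots> = r m l" by (rule sum_unit_residual[OF assms])
    finally show ?thesis .
  qed
  then show ?thesis
    unfolding residual_linear_def
    by (intro exI[of _ 0] exI[of _ "\<lambda>m' l'. if m' = m \<and> l' = l then 1 else 0"]) simp
qed

lemma residual_linear_ee_stage:
  assumes "m \<le> p" "j \<le> m"
  shows "residual_linear p (\<lambda>z U r. ee_stage z U r m j)"
  using assms(2)
proof (induction j)
  case 0
  show ?case by (simp add: residual_linear_initial)
next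
  case (Suc j)
  have "residual_linear p (\<lambda>z U r. poly [:1, 1 / of_nat m:] z * ee_stage z U r m j + r m (Suc j))"
    by (intro residual_linear_add residual_linear_mult residual_linear_residual)
       (use Suc assms in auto)
  then show ?case by simp
qed

lemma residual_linear_ee_tableau:
  assumes "1 \<le> k" "k \<le> j" "j \<le> p"
  shows "residual_linear p (\<lambda>z U r. ee_tableau z U r j k)"
  using assms
proof (induction k arbitrary: j rule: nat_induct_at_least)
  case base
  then show ?case
    by (subst ee_tableau.simps) (simp add: residual_linear_ee_stage)
next
  case (Suc k)
  define c :: complex where "c = 1 / (of_nat j / of_nat (j - Suc k + 1) - 1)"
  have "ee_tableau z U r j (Suc k) =
      poly [:1 + c:] z * ee_tableau z U r j k + poly [:- c:] z * ee_tableau z U r (j - 1) k"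
    for z U r
    using Suc.hyps by (subst ee_tableau.simps) (simp add: c_def diff_divide_distrib ring_distribs)
  moreover have "residual_linear p (\<lambda>z U r.
      poly [:1 + c:] z * ee_tableau z U r j k + poly [:- c:] z * ee_tableau z U r (j - 1) k)"
    by (intro residual_linear_add residual_linear_mult Suc.IH) (use Suc in auto)
  ultimately show ?case by simp
qed

lemma ee_expansion_exists:
  assumes "1 \<le> p"
  shows "\<exists>P Q. ee_expansion p P Q"
  using residual_linear_ee_tableau[of p p p] assms
  unfolding residual_linear_def ee_expansion_def ee_step_def by simp

lemma ee_expansion_coeff:
  assumes "ee_expansion p P Q" "1 \<le> l" "l \<le> m" "m \<le> p"
  shows "poly (Q m l) z = ee_step p z 0 (\<lambda>m' l'. if m' = m \<and> l' = l then 1 else 0)"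
  using assms sum_unit_residual[OF assms(2-4), of "\<lambda>m l. poly (Q m l) z"]
  unfolding ee_expansion_def by simp

lemma ee_Q_ex1:
  assumes "1 \<le> l" "l \<le> m" "m \<le> p"
  shows "\<exists>!q. \<exists>P Q. ee_expansion p P Q \<and> Q m l = q"
proof -
  have "Q m l = Q' m l" if "ee_expansion p P Q" "ee_expansion p P' Q'" for P Q P' Q'
    using ee_expansion_coeff[OF that(1) assms] ee_expansion_coeff[OF that(2) assms]
    by (intro iffD1[OF poly_eq_poly_eq_iff] ext) simp
  then show ?thesis
    using ee_expansion_exists[of p] assms by (metis le_trans)
qed

lemma ee_Q_eq:
  assumes "ee_expansion p P Q" "1 \<le> l" "l \<le> m" "m \<le> p"
  shows "ee_Q p m l = Q m l"
  unfolding ee_Q_def using ee_Q_ex1[OF assms(2-4)] assms(1) by (intro the1_equality) blast+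

lemma ee_expansion_ee_Q:
  assumes "1 \<le> p"
  shows "\<exists>P. ee_expansion p P (ee_Q p)"
proof -
  obtain P Q where PQ: "ee_expansion p P Q"
    using ee_expansion_exists[OF assms] by blast
  have "(\<Sum>m=1..p. \<Sum>l=1..m. poly (ee_Q p m l) z * r m l) =
        (\<Sum>m=1..p. \<Sum>l=1..m. poly (Q m l) z * r m l)" for z r
    by (intro sum.cong refl) (auto simp: ee_Q_eq[OF PQ])
  with PQ have "ee_expansion p P (ee_Q p)"
    unfolding ee_expansion_def by simp
  then show ?thesis ..
qed

lemma lambert_W_ex1:
  fixes x :: real
  assumes "x \<ge> - 1 / exp 1"
  shows "\<exists>!w. w \<ge> -1 \<and> w * exp w = x"
proof -
  let ?f = "\<lambda>w::real. w * exp w"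
  have mono: "?f a < ?f b" if "-1 \<le> a" "a < b" for a b
  proof (rule DERIV_pos_imp_increasing_open[OF that(2)])
    fix t assume "a < t" "t < b"
    have "(?f has_real_derivative (1 + t) * exp t) (at t)"
      by (auto intro!: derivative_eq_intros simp: algebra_simps)
    moreover have "(1 + t) * exp t > 0" using \<open>a < t\<close> that by simp
    ultimately show "\<exists>y. (?f has_real_derivative y) (at t) \<and> 0 < y" by blast
  qed (auto intro!: continuous_intros)
  have "x \<le> \<bar>x\<bar> * 1" by simp
  also have "\<dots> \<le> \<bar>x\<bar> * exp \<bar>x\<bar>" by (intro mult_left_mono) auto
  finally have ub: "x \<le> ?f \<bar>x\<bar>" .
  have lb: "?f (-1) \<le> x" using assms by (simp add: exp_minus divide_inverse)
  have "\<exists>w\<ge>-1. w \<le> \<bar>x\<bar> \<and> ?f w = x"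
    by (rule IVT') (use lb ub in \<open>auto intro!: continuous_intros\<close>)
  then obtain w where "w \<ge> -1" "?f w = x" by blast
  moreover have "v = w" if "v \<ge> -1" "?f v = x" for v
    using mono[of v w] mono[of w v] that \<open>w \<ge> -1\<close> \<open>?f w = x\<close> by (cases v w rule: linorder_cases) auto
  ultimately show ?thesis by blast
qed

end

theory Submission
  imports Defs
begin

text \<open>
  Extrapolation is linear in the stage results \<open>T\<^sub>m\<^sub>,\<^sub>1\<close>, and unrolling the tableau
  (\<open>ee_tableau_closed_form\<close>) gives the weight of each of them. A unit residual at
  \<open>(m, l)\<close> changes only \<open>T\<^sub>m\<^sub>,\<^sub>1\<close>, by \<open>(1 + z / m) ^ (m - l)\<close>, so that (\<open>poly_ee_Q\<close>)
  the polynomial of that residual has modulus \<open>m ^ p / (m! (p - m)!) * |1 + z / m| ^ (m - l)\<close>.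
  The two factors are bounded separately.

  The stability polynomial is a partial sum \<open>s\<^sub>p\<close> of the exponential series. Multiplying it by
  \<open>z - p\<close> leaves no positive coefficient below the leading one, and from this
  \<open>(r - p) s\<^sub>p(r) \<le> (r + p) |s\<^sub>p(z)|\<close> for \<open>|z| = r\<close> (\<open>exp_partial_sum_lower\<close>). As
  \<open>s\<^sub>p(r)\<close> is large, the stability region lies in the disc of radius \<open>1.15 p\<close> for \<open>p \<ge> 3\<close>
  (\<open>ee_stability_region_radius\<close>). Since \<open>(1 + a N / M) ^ M\<close> increases with \<open>M\<close> up to its value
  \<open>(1 + a) ^ N\<close> at \<open>M = N\<close>, the second factor is at most \<open>2.15 ^ (p - 1)\<close>.

  In the weight, \<open>m ^ m / m!\<close> is at most \<open>exp m\<close>, while \<open>m ^ k / k!\<close> with \<open>k = p - m\<close> is at most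
  \<open>exp (w m) / w ^ k\<close> for every \<open>w > 0\<close>. The product is \<open>exp ((1 + w) m) / w ^ k\<close>, and it no
  longer depends on \<open>m\<close> when \<open>exp (1 + w) = 1 / w\<close>, that is, when \<open>w = W(1/e)\<close>; it is then
  \<open>w ^ (- p)\<close>. Applying a Stirling type bound to both factorials improves this by a factor of order
  \<open>sqrt (m (p - m)) \<ge> sqrt (p - 1)\<close> (\<open>tableau_weight_le\<close>). The bound used here has
  \<open>exp (3/4) \<approx> 2.12\<close> in place of the sharp constant \<open>sqrt (2 pi) \<approx> 2.51\<close>. The gap between the base
  \<open>2.15\<close> and the \<open>2.6\<close> of the claim absorbs this loss.

  The weight bound excludes \<open>m = p\<close>, where \<open>k = 0\<close>. There the weight is at most \<open>exp p\<close>, which is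
  smaller than \<open>w ^ (- p)\<close> by the geometric factor \<open>(e w) ^ p\<close>. The case \<open>p = 2\<close> is elementary:
  \<open>s\<^sub>2(z) = ((1 + z)\<^sup>2 + 1) / 2\<close> confines the stability region to \<open>|1 + z| \<le> 2\<close>.
\<close>

section \<open>The internal stability polynomials\<close>

text \<open>
  Up to the factor \<open>d!\<close>, the entry is the \<open>d\<close>-th forward difference of \<open>x ^ d * S x\<close> at \<open>a\<close>,
  where \<open>S x\<close> is the result of \<open>x\<close> Euler substeps. It combines the rows \<open>a, ..., a + d\<close> of the first
  column; indexing it by \<open>a\<close> and \<open>d\<close> avoids truncated subtraction and turns the recursion into
  \<open>d T(a, d) = (a + d) T(a + 1, d - 1) - a T(a, d - 1)\<close>.
\<close>

lemma ee_tableau_closed_form: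
  assumes "1 \<le> a"
  shows "ee_tableau z U r (a + d) (Suc d) =
    (\<Sum>i\<le>d. (-1) ^ (d + i) * of_nat (d choose i) * of_nat (a + i) ^ d * ee_stage z U r (a + i) (a + i))
      / fact d"
  using assms
proof (induction d arbitrary: a)
  case 0
  then show ?case by (subst ee_tableau.simps) simp
next
  case (Suc d)
  define S where "S i = (-1) ^ (d + i) * of_nat (a + i) ^ d * ee_stage z U r (a + i) (a + i)" for i
  have step: "ee_tableau z U r (a + Suc d) (Suc (Suc d)) =
      (of_nat (a + d + 1) * ee_tableau z U r (Suc a + d) (Suc d)
        - of_nat a * ee_tableau z U r (a + d) (Suc d)) / of_nat (Suc d)"
  proof -
    have index: "a + Suc d - Suc (Suc d) + 1 = a"
      using Suc.prems by simp
    have denominator: "of_nat (a + Suc d) / of_nat a - 1 = (of_nat (Suc d) / of_nat a :: complex)"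
      using Suc.prems by (simp add: field_simps)
    have "ee_tableau z U r (a + Suc d) (Suc (Suc d)) = ee_tableau z U r (Suc a + d) (Suc d) +
        (ee_tableau z U r (Suc a + d) (Suc d) - ee_tableau z U r (a + d) (Suc d)) /
          (of_nat (Suc d) / of_nat a)"
      by (subst ee_tableau.simps) (simp only: index denominator, simp)
    moreover have "(of_nat (Suc d) :: complex) \<noteq> 0"
      by (simp del: of_nat_Suc)
    ultimately show ?thesis
      by (simp add: field_simps del: of_nat_Suc) (simp add: algebra_simps)
  qed
  \<comment> \<open>Pascal's rule weighted by \<open>a + i\<close>: it splits the new coefficients into those of the two parents.\<close>
  have coeff: "of_nat (a + i) * of_nat (Suc d choose i) = (of_nat a * of_nat (d choose i)
        + of_nat (a + d + 1) * (case i of 0 \<Rightarrow> 0 | Suc j \<Rightarrow> of_nat (d choose j)) :: complex)" for i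
  proof (cases i)
    case (Suc j)
    have "(a + i) * (Suc d choose i) = a * (Suc d choose Suc j) + Suc j * (Suc d choose Suc j)"
      by (simp add: Suc algebra_simps)
    also have "\<dots> = a * (d choose i) + (a + d + 1) * (d choose j)"
      using Suc_times_binomial_eq[of d j] by (simp add: Suc algebra_simps)
    finally show ?thesis
      unfolding Suc by (simp only: of_nat_mult[symmetric] of_nat_add[symmetric] nat.case)
  qed simp
  have "(\<Sum>i\<le>Suc d. (-1) ^ (Suc d + i) * of_nat (Suc d choose i) * of_nat (a + i) ^ Suc d
          * ee_stage z U r (a + i) (a + i))
      = - (\<Sum>i\<le>Suc d. of_nat (a + i) * of_nat (Suc d choose i) * S i)"
    by (simp only: S_def sum_negf[symmetric]) (intro sum.cong refl, simp add: mult_ac)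
  also have "\<dots> = - of_nat a * (\<Sum>i\<le>Suc d. of_nat (d choose i) * S i)
      - of_nat (a + d + 1) * (\<Sum>i\<le>Suc d. (case i of 0 \<Rightarrow> 0 | Suc j \<Rightarrow> of_nat (d choose j)) * S i)"
    unfolding coeff by (simp only: ring_distribs sum.distrib sum_distrib_left mult.assoc) (simp add: sum_negf)
  also have "(\<Sum>i\<le>Suc d. (case i of 0 \<Rightarrow> 0 | Suc j \<Rightarrow> of_nat (d choose j)) * S i) =
      (\<Sum>i\<le>d. of_nat (d choose i) * S (Suc i))"
    by (subst sum.atMost_Suc_shift) simp
  also have "(\<Sum>i\<le>d. of_nat (d choose i) * S (Suc i)) = - (fact d * ee_tableau z U r (Suc a + d) (Suc d))"
    unfolding S_def by (subst Suc.IH) (simp_all add: sum_negf mult_ac del: of_nat_Suc)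
  also have "(\<Sum>i\<le>Suc d. of_nat (d choose i) * S i) = fact d * ee_tableau z U r (a + d) (Suc d)"
    unfolding S_def using Suc.prems by (subst Suc.IH) (simp_all add: mult_ac)
  also have "- of_nat a * (fact d * ee_tableau z U r (a + d) (Suc d))
        - of_nat (a + d + 1) * - (fact d * ee_tableau z U r (Suc a + d) (Suc d)) =
      fact d * (of_nat (a + d + 1) * ee_tableau z U r (Suc a + d) (Suc d)
        - of_nat a * ee_tableau z U r (a + d) (Suc d))"
    by (simp only: ring_distribs) (simp add: algebra_simps)
  finally show ?case
    unfolding step fact_Suc by (simp del: of_nat_Suc of_nat_add)
qed

lemma ee_stage_unit_residual:
  assumes "1 \<le> l" "l \<le> m"
  shows "ee_stage z 0 (\<lambda>m' l'. if m' = m \<and> l' = l then 1 else 0) i j =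
    (if i = m \<and> l \<le> j then (1 + z / of_nat m) ^ (j - l) else 0)"
  using assms by (induction j) (auto simp: Suc_diff_le le_Suc_eq)

text \<open>
  A unit residual isolates one polynomial, and only the summand with index \<open>m\<close> of the closed form,
  at the offset \<open>m - 1\<close> from the first entry \<open>a = 1\<close>, is then nonzero.
\<close>

lemma poly_ee_Q:
  assumes "1 \<le> l" "l \<le> m" "m \<le> p"
  shows "poly (ee_Q p m l) z =
    (-1) ^ (p + m) * of_nat m ^ p / (fact m * fact (p - m)) * (1 + z / of_nat m) ^ (m - l)"
proof -
  obtain P where "ee_expansion p P (ee_Q p)"
    using ee_expansion_ee_Q[of p] assms by auto
  then have "poly (ee_Q p m l) z =
      ee_tableau z 0 (\<lambda>m' l'. if m' = m \<and> l' = l then 1 else 0) (1 + (p - 1)) (Suc (p - 1))"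
    using assms by (subst ee_expansion_coeff) (auto simp: ee_step_def)
  also have "\<dots> = (\<Sum>i\<le>p - 1. if i = m - 1 then
      (-1) ^ (p - 1 + (m - 1)) * of_nat (p - 1 choose (m - 1)) * of_nat m ^ (p - 1)
        * (1 + z / of_nat m) ^ (m - l) else 0) / fact (p - 1)"
    unfolding ee_tableau_closed_form[OF le_refl] ee_stage_unit_residual[OF assms(1,2)]
    using assms by (intro arg_cong2[where f = "(/)"] sum.cong refl) auto
  also have "\<dots> = (-1) ^ (p - 1 + (m - 1)) * of_nat m ^ (p - 1) * (of_nat (p - 1 choose (m - 1)) / fact (p - 1))
        * (1 + z / of_nat m) ^ (m - l)"
    using assms by (simp add: sum.delta)
  also have "of_nat (p - 1 choose (m - 1)) / fact (p - 1) = (1 / (fact (m - 1) * fact (p - m)) :: complex)"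
    using assms by (subst binomial_fact) (auto simp: field_simps)
  also have "(-1) ^ (p - 1 + (m - 1)) = ((-1) ^ (p + m) :: complex)"
    using assms by (cases p; cases m) auto
  also have "(-1) ^ (p + m) * of_nat m ^ (p - 1) * (1 / (fact (m - 1) * fact (p - m))) =
      (-1) ^ (p + m) * of_nat m ^ p / (fact m * fact (p - m) :: complex)"
  proof -
    have "(of_nat m :: complex) ^ p = of_nat m * of_nat m ^ (p - 1)"
      "fact m = (of_nat m * fact (m - 1) :: complex)" "(of_nat m :: complex) \<noteq> 0"
      using assms by (auto simp: power_eq_if fact_reduce)
    then show ?thesis by simp
  qed
  finally show ?thesis .
qed

lemma ee_max_amplification_leI:
  assumes "1 \<le> p"
    and "\<And>m l z. 1 \<le> l \<Longrightarrow> l \<le> m \<Longrightarrow> m \<le> p \<Longrightarrow> z \<in> S \<Longrightarrow>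
      real m ^ p / (fact m * fact (p - m)) * cmod (1 + z / of_nat m) ^ (m - l) \<le> B"
  shows "ee_max_amplification p S \<le> ereal B"
proof -
  have "cmod (poly (ee_Q p m l) z) \<le> B" if "1 \<le> l" "l \<le> m" "m \<le> p" "z \<in> S" for m l z
    using assms(2)[OF that] poly_ee_Q[OF that(1-3), of z]
    by (simp add: norm_mult norm_divide norm_power)
  then show ?thesis
    using assms(1) unfolding ee_max_amplification_def by (auto intro!: SUP_least)
qed

section \<open>The radius of the stability region\<close>

text \<open>
  The factor \<open>z - c\<close> makes the coefficient of \<open>z ^ k\<close> equal to \<open>(k - c) / k!\<close>, so with \<open>c = n\<close> every
  coefficient except the leading one is at most zero.
\<close>

lemma exp_partial_sum_shift:
  fixes z :: "'a::real_normed_field"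
  shows "(z - c) * (\<Sum>k=0..n. z ^ k / fact k) =
    z ^ Suc n / fact n - (\<Sum>k=0..n. (c - of_nat k) * (z ^ k / fact k))"
proof (induction n)
  case (Suc n)
  define t where "t = z ^ Suc n / fact (Suc n)"
  have "z ^ Suc n / fact n = of_nat (Suc n) * t" "z ^ Suc (Suc n) / fact (Suc n) = z * t"
    by (simp_all add: t_def field_simps del: of_nat_Suc)
  with Suc show ?case
    unfolding sum.atLeast0_atMost_Suc t_def[symmetric] by (simp only: ring_distribs) (simp add: algebra_simps)
qed (simp add: algebra_simps)

text \<open>
  The norm of the right-hand side of \<open>exp_partial_sum_shift\<close> is at least that of its leading term minus
  the norms of the others. The others share one sign, so this difference is the same right-hand side at
  the real point \<open>norm z\<close>, and the identity, read backwards there, returns the partial sum. The factor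
  \<open>norm z + p\<close> bounds \<open>norm (z - p)\<close>.
\<close>

lemma exp_partial_sum_lower:
  fixes z :: "'a::real_normed_field"
  shows "(norm z - real p) * (\<Sum>k=0..p. norm z ^ k / fact k) \<le>
    (norm z + real p) * norm (\<Sum>k=0..p. z ^ k / fact k)"
proof -
  have "norm (\<Sum>k=0..p. (of_nat p - of_nat k) * (z ^ k / fact k)) \<le>
      (\<Sum>k=0..p. (real p - real k) * (norm z ^ k / fact k))"
  proof (rule sum_norm_le)
    fix k assume "k \<in> {0..p}"
    then have "norm (of_nat p - of_nat k :: 'a) = real p - real k"
      by (metis atLeastAtMost_iff norm_of_nat of_nat_diff)
    then show "norm ((of_nat p - of_nat k) * (z ^ k / fact k)) \<le> (real p - real k) * (norm z ^ k / fact k)"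
      by (simp add: norm_mult norm_divide norm_power)
  qed
  then have "(norm z - real p) * (\<Sum>k=0..p. norm z ^ k / fact k) \<le>
      norm (z ^ Suc p / fact p) - norm (\<Sum>k=0..p. (of_nat p - of_nat k) * (z ^ k / fact k))"
    unfolding exp_partial_sum_shift by (simp add: norm_divide norm_mult norm_power)
  also have "\<dots> \<le> norm ((z - of_nat p) * (\<Sum>k=0..p. z ^ k / fact k))"
    unfolding exp_partial_sum_shift by (rule norm_triangle_ineq2)
  also have "\<dots> \<le> (norm z + real p) * norm (\<Sum>k=0..p. z ^ k / fact k)"
    unfolding norm_mult using norm_triangle_ineq4[of z "of_nat p"]
    by (intro mult_right_mono) auto
  finally show ?thesis .
qed

lemma ee_stability_region_radius:
  assumes "3 \<le> p" "z \<in> ee_stability_region p"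
  shows "cmod z \<le> 23 / 20 * real p"
proof (rule ccontr)
  define r where "r = cmod z"
  assume "\<not> ?thesis"
  then have r: "r > 23 / 20 * real p" by (simp add: r_def)
  with assms have r3: "r \<ge> 69 / 20" by simp
  \<comment> \<open>The cubic partial sum exceeds 17 at \<open>1.15 * 3 = 69/20\<close>. With \<open>s\<^sub>p(r) \<ge> 17\<close> the lower bound gives
      \<open>17 (r - p) \<le> r + p\<close>, that is \<open>r \<le> 1.125 p\<close>.\<close>
  have "17 \<le> 1 + (69/20) + (69/20)^2/2 + (69/20)^3/(6::real)" by (simp add: eval_nat_numeral)
  also have "\<dots> \<le> 1 + r + r^2/2 + r^3/6"
    using r3 by (intro add_mono divide_right_mono power_mono) auto
  also have "\<dots> = (\<Sum>k=0..3. r ^ k / fact k)"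
    by (simp add: eval_nat_numeral)
  also have "\<dots> \<le> (\<Sum>k=0..p. r ^ k / fact k)"
    using assms r3 by (intro sum_mono2) auto
  finally have "17 * (r - real p) \<le> (r - real p) * (\<Sum>k=0..p. r ^ k / fact k)"
    using r by (subst mult.commute) (intro mult_left_mono, auto)
  also have "\<dots> \<le> (r + real p) * cmod (\<Sum>k=0..p. z ^ k / fact k)"
    unfolding r_def by (rule exp_partial_sum_lower)
  also have "\<dots> \<le> (r + real p) * 1"
    using assms r3 by (intro mult_left_mono) (auto simp: ee_stability_region_def)
  finally show False using r by simp
qed

section \<open>The extrapolation weights\<close>

text \<open>
  Stirling's lower bound with \<open>exp (3/4)\<close> in place of \<open>sqrt (2 pi)\<close>. The trapezoidal upper bound for
  \<open>ln (n + 1) - ln n\<close> limits the decrease of \<open>ln n! - (n + 1/2) ln n + n\<close> in one step to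
  \<open>1 / (4 n) - 1 / (4 (n + 1))\<close>. These terms telescope, so all steps from \<open>n = 1\<close>, where the value
  is 1, lose less than \<open>1/4\<close>.
\<close>

lemma fact_lower_bound:
  assumes "1 \<le> n"
  shows "exp (3/4) * sqrt (real n) * (real n / exp 1) ^ n \<le> fact n"
proof -
  \<comment> \<open>The term \<open>1 / (4 n)\<close> strengthens the claim so that the telescoping becomes an induction.\<close>
  have "3/4 + 1 / (4 * real n) + (real n + 1/2) * ln (real n) - real n \<le> ln (fact n)"
    using assms
  proof (induction n rule: nat_induct_at_least)
    case (Suc n)
    have "ln (real n + 1) - ln (real n) \<le> (1 / real n + 1 / (real n + 1)) / 2"
      using ln_inverse_approx_le[of "real n" 1] Suc by (simp add: inverse_eq_divide)
    then have "(real n + 1/2) * (ln (real n + 1) - ln (real n)) \<le>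
        (real n + 1/2) * ((1 / real n + 1 / (real n + 1)) / 2)"
      by (intro mult_left_mono) auto
    also have "\<dots> = 1 + 1 / (4 * real n) - 1 / (4 * (real n + 1))"
      using Suc by (simp add: divide_simps) (simp add: algebra_simps)
    finally have *: "(real n + 1/2) * (ln (real n + 1) - ln (real n)) \<le>
      1 + 1 / (4 * real n) - 1 / (4 * (real n + 1))" .
    have "ln (fact (Suc n)) = ln (real n + 1) + ln (fact n)"
      by (simp add: ln_mult add.commute)
    then show ?case
      using * Suc.IH by (simp add: algebra_simps)
  qed simp
  moreover have "0 \<le> 1 / (4 * real n)" by simp
  ultimately have "3/4 + (real n + 1/2) * ln (real n) - real n \<le> ln (fact n)" by linarith
  then have "exp (3/4 + (real n + 1/2) * ln (real n) - real n) \<le> fact n"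
    by (subst (asm) exp_le_cancel_iff[symmetric]) simp
  also have "3/4 + (real n + 1/2) * ln (real n) - real n = 3/4 + ln (sqrt (real n)) + real n * (ln (real n) - 1)"
    using assms by (simp add: ln_sqrt algebra_simps)
  also have "exp \<dots> = exp (3/4) * sqrt (real n) * (real n / exp 1) ^ n"
    using assms by (simp add: exp_add exp_diff exp_of_nat_mult)
  finally show ?thesis .
qed

lemma power_over_fact_le:
  assumes "1 \<le> n" "0 < x"
  shows "x ^ n / fact n \<le> (exp 1 * x / real n) ^ n / (exp (3/4) * sqrt (real n))"
proof -
  have "x ^ n / fact n \<le> x ^ n / (exp (3/4) * sqrt (real n) * (real n / exp 1) ^ n)"
    using assms by (intro divide_left_mono fact_lower_bound mult_pos_pos) auto
  also have "\<dots> = (exp 1 * x / real n) ^ n / (exp (3/4) * sqrt (real n))"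
    using assms by (simp add: field_simps)
  finally show ?thesis .
qed

text \<open>
  The tangent inequality \<open>e y \<le> exp y\<close> at \<open>y = x / k\<close>, raised to the power \<open>k\<close>. It replaces the
  \<open>(e m / k) ^ k\<close> of Stirling's formula by a quantity whose dependence on \<open>m\<close> is purely exponential.
\<close>

lemma exp_1_mult_div_power_le:
  assumes "1 \<le> k" "0 \<le> x"
  shows "(exp 1 * x / real k) ^ k \<le> exp (x::real)"
proof -
  have "x / real k \<le> exp (x / real k - 1)"
    using exp_ge_add_one_self[of "x / real k - 1"] by simp
  then have "exp 1 * x / real k \<le> exp (x / real k)"
    by (simp add: exp_diff field_simps)
  then have "(exp 1 * x / real k) ^ k \<le> exp (x / real k) ^ k"
    using assms by (intro power_mono) auto
  also have "\<dots> = exp x"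
    using assms by (simp flip: exp_of_nat_mult)
  finally show ?thesis .
qed

text \<open>
  The equation for \<open>w\<close> says \<open>exp (1 + w) = 1 / w\<close>; it makes the exponential growth in \<open>m\<close> and the
  geometric growth in \<open>p - m\<close> have the same rate, and the bound uniform in \<open>m\<close>.
\<close>

lemma tableau_weight_le:
  fixes w :: real
  assumes w: "0 < w" "w * exp (1 + w) = 1" and m: "1 \<le> m" "m < p"
  shows "real m ^ p / (fact m * fact (p - m)) \<le> (1 / w) ^ p / (exp (3/2) * sqrt (real p - 1))"
proof -
  define k where "k = p - m"
  have k: "1 \<le> k" "p = m + k" using m by (auto simp: k_def)
  have e1: "exp (1 + w) = 1 / w" using w by (simp add: field_simps)
  have A: "real m ^ m / fact m \<le> exp (real m) / (exp (3/4) * sqrt (real m))"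
    using power_over_fact_le[of m "real m"] m by (simp flip: exp_of_nat_mult)
  have "real m ^ k / fact k \<le> (exp 1 * real m / real k) ^ k / (exp (3/4) * sqrt (real k))"
    using power_over_fact_le[of k "real m"] k m by simp
  also have "(exp 1 * real m / real k) ^ k = (1 / w) ^ k * (exp 1 * (w * real m) / real k) ^ k"
    using w by (simp flip: power_mult_distrib)
  also have "\<dots> \<le> (1 / w) ^ k * exp (w * real m)"
    using w k by (intro mult_left_mono exp_1_mult_div_power_le) auto
  finally have B: "real m ^ k / fact k \<le> (1 / w) ^ k * exp (w * real m) / (exp (3/4) * sqrt (real k))"
    by (simp add: divide_right_mono)
  have "real m ^ p / (fact m * fact (p - m)) = (real m ^ m / fact m) * (real m ^ k / fact k)"
    unfolding k_def[symmetric] k(2) by (simp add: power_add)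
  also have "\<dots> \<le> (exp (real m) / (exp (3/4) * sqrt (real m))) *
      ((1 / w) ^ k * exp (w * real m) / (exp (3/4) * sqrt (real k)))"
    using A B by (intro mult_mono) auto
  also have "\<dots> = (exp (real m) * exp (w * real m)) * (1 / w) ^ k /
      ((exp (3/4) * exp (3/4)) * (sqrt (real m) * sqrt (real k)))"
    by (simp only: times_divide_times_eq mult_ac)
  also have "exp (real m) * exp (w * real m) = exp (1 + w) ^ m"
    by (simp add: ring_distribs mult.commute flip: exp_add exp_of_nat_mult)
  also have "exp (3/4) * exp (3/4) = exp (3/2 :: real)"
    by (simp flip: exp_add)
  also have "sqrt (real m) * sqrt (real k) = sqrt (real m * real k)"
    by (simp add: real_sqrt_mult)
  also have "exp (1 + w) ^ m * (1 / w) ^ k = (1 / w) ^ p"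
    unfolding e1 k(2) by (simp add: power_add)
  also have "(1 / w) ^ p / (exp (3/2) * sqrt (real m * real k)) \<le>
      (1 / w) ^ p / (exp (3/2) * sqrt (real p - 1))"
  proof -
    \<comment> \<open>Under \<open>m + k = p\<close> the product \<open>m k\<close> is smallest at the ends \<open>m = 1\<close> and \<open>k = 1\<close>.\<close>
    have "0 \<le> (real m - 1) * (real k - 1)" using m k by (intro mult_nonneg_nonneg) auto
    then have "real p - 1 \<le> real m * real k" using k by (simp add: algebra_simps)
    then show ?thesis using m k w
      by (intro divide_left_mono mult_left_mono mult_pos_pos) auto
  qed
  finally show ?thesis .
qed

section \<open>Powers of the Euler factor\<close>

text \<open>
  Bernoulli's inequality for the exponent \<open>N / M \<ge> 1\<close>, in a form with natural powers only. It follows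
  from convexity of \<open>exp\<close> between \<open>0\<close> and \<open>u = ln (1 + a N / M)\<close>, with weight \<open>M / N\<close> on \<open>u\<close>.
\<close>

lemma one_plus_power_le:
  fixes a :: real
  assumes "0 \<le> a" "M \<le> N" "1 \<le> N"
  shows "(1 + a * (real N / real M)) ^ M \<le> (1 + a) ^ N"
proof (cases "M = 0")
  case False
  define u where "u = ln (1 + a * (real N / real M))"
  define t where "t = real M / real N"
  have t: "0 < t" "t \<le> 1" using False assms by (auto simp: t_def)
  have u: "exp u = 1 + a / t" unfolding u_def t_def using assms
    by (subst exp_ln) (auto intro!: add_pos_nonneg)
  have "exp ((1 - t) *\<^sub>R 0 + t *\<^sub>R u) \<le> (1 - t) * exp 0 + t * exp u"
    using t by (intro convex_onD[OF exp_convex]) auto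
  then have "exp (t * u) \<le> 1 + a" using t unfolding u by (simp add: algebra_simps)
  then have "exp (t * u) ^ N \<le> (1 + a) ^ N" by (intro power_mono) auto
  moreover have "exp (t * u) ^ N = exp u ^ M"
    using assms by (simp add: t_def flip: exp_of_nat_mult)
  moreover have "exp u = 1 + a * (real N / real M)" using u by (simp add: t_def)
  ultimately show ?thesis by simp
qed (use assms in simp)

lemma stage_factor_le:
  assumes p: "3 \<le> p" and "1 \<le> l" "l \<le> m" "m \<le> p" and z: "z \<in> ee_stability_region p"
  shows "cmod (1 + z / of_nat m) ^ (m - l) \<le> (43 / 20) ^ (p - 1)"
proof (cases "m = 1")
  case False
  then have m: "2 \<le> m" using assms by simp
  have "cmod (1 + z / of_nat m) \<le> 1 + cmod z / real m"
    using norm_triangle_ineq[of 1 "z / of_nat m"] by (simp add: norm_divide)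
  also have "cmod z / real m \<le> (23 / 20 * real p) / real m"
    by (intro divide_right_mono ee_stability_region_radius assms) auto
  \<comment> \<open>Passing to \<open>p - 1\<close> and \<open>m - 1\<close> matches the largest exponent, \<open>m - 1\<close>, attained at \<open>l = 1\<close>.\<close>
  also have "\<dots> \<le> 23 / 20 * (real (p - 1) / real (m - 1))"
    using m assms by (auto simp: field_simps of_nat_diff)
  finally have "cmod (1 + z / of_nat m) ^ (m - l) \<le> (1 + 23 / 20 * (real (p - 1) / real (m - 1))) ^ (m - l)"
    by (intro power_mono) auto
  also have "\<dots> \<le> (1 + 23 / 20 * (real (p - 1) / real (m - 1))) ^ (m - 1)"
    using assms by (intro power_increasing) auto
  also have "\<dots> \<le> (1 + 23 / 20) ^ (p - 1)"
    using assms by (intro one_plus_power_le) auto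
  finally show ?thesis by simp
qed (use assms in \<open>auto intro: one_le_power\<close>)

section \<open>The value of the Lambert function\<close>

text \<open>
  The value is \<open>0.27846...\<close>. The lower bound \<open>2.6 / 9.34 = 0.27837...\<close> is equivalent to the second
  inequality of the theorem; in \<open>w * exp (1 + w)\<close> it leaves a relative margin of about \<open>4 / 10000\<close>, whence the Taylor polynomial of degree 4;
  the upper bound serves the case \<open>m = p\<close> and may be coarse.
\<close>

lemma lambert_W_inverse_e:
  fixes w :: real
  defines "w \<equiv> lambert_W (1 / exp 1)"
  shows "0 < w"
    and "w * exp (1 + w) = 1"
    and "2.6 / 9.34 < w"
    and "w \<le> 0.28"
proof -
  have "- 1 / exp 1 \<le> (1 / exp 1 :: real)" by (simp add: divide_right_mono)
  from theI'[OF lambert_W_ex1[OF this]] have *: "w \<ge> -1" "w * exp w = 1 / exp 1"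
    unfolding w_def lambert_W_def by auto
  show eq: "w * exp (1 + w) = 1"
    using * by (simp add: exp_add field_simps)
  then show pos: "0 < w"
    by (metis exp_gt_zero zero_less_mult_pos2 zero_less_one)
  show "2.6 / 9.34 < w"
  proof (rule ccontr)
    define q where "q = (2.6 / 9.34 :: real)"
    assume "\<not> ?thesis"
    then have "w \<le> q" by (simp add: q_def)
    obtain t where t: "\<bar>t\<bar> \<le> \<bar>q\<bar>" "exp q = (\<Sum>m<5. q ^ m / fact m) + exp t / fact 5 * q ^ 5"
      using Maclaurin_exp_le by blast
    have "t \<le> 1" using t(1) by (simp add: q_def)
    then have "exp t \<le> 3" using exp_le order_trans exp_le_cancel_iff by blast
    then have "exp t / fact 5 * q ^ 5 \<le> 3 / fact 5 * q ^ 5"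
      by (intro mult_right_mono divide_right_mono) (auto simp: q_def)
    then have "exp q \<le> (\<Sum>m<5. q ^ m / fact m) + 3 / fact 5 * q ^ 5"
      using t(2) by simp
    also have "\<dots> \<le> 1.32105"
      by (simp add: q_def eval_nat_numeral)
    finally have "exp 1 * exp q \<le> 2.71829 * 1.32105"
      using e_approx_32 by (intro mult_mono) (auto simp: abs_if split: if_splits)
    then have "q * exp (1 + q) \<le> q * (2.71829 * 1.32105)"
      unfolding exp_add by (intro mult_left_mono) (auto simp: q_def)
    also have "\<dots> < 1" by (simp add: q_def)
    also have "1 = w * exp (1 + w)" using eq by simp
    also have "\<dots> \<le> q * exp (1 + q)"
      using \<open>w \<le> q\<close> pos by (intro mult_mono) auto
    finally show False by simp
  qed
  show "w \<le> 0.28"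
  proof (rule ccontr)
    assume "\<not> ?thesis"
    then have w: "w > 0.28" by simp
    \<comment> \<open>The bound \<open>1 + x \<le> exp x\<close> is accurate enough only for small \<open>x\<close>, hence the eighth root.\<close>
    have "exp (0.28 :: real) = exp 0.035 ^ (8::nat)"
      by (simp flip: exp_of_nat_mult)
    moreover have "(1 + 0.035) ^ (8::nat) \<le> exp (0.035::real) ^ (8::nat)"
      by (intro power_mono exp_ge_add_one_self) auto
    ultimately have "1.3168 \<le> exp (0.28::real)"
      by (simp add: eval_nat_numeral)
    moreover have "2.718 \<le> exp (1::real)"
      using e_approx_32 by (simp add: abs_if split: if_splits)
    ultimately have "0.28 * (2.718 * 1.3168) \<le> 0.28 * (exp 1 * exp (0.28::real))"
      by (intro mult_left_mono mult_mono) auto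
    also have "\<dots> = 0.28 * exp (1 + 0.28)"
      by (simp only: exp_add)
    also have "\<dots> \<le> w * exp (1 + w)"
      using w by (intro mult_mono) auto
    finally show False using eq by simp
  qed
qed

section \<open>The amplification bounds\<close>

text \<open>
  The target is rewritten with \<open>2.6 ^ p / 5.2 = 2.6 ^ (p - 1) / 2\<close>, so that \<open>w ^ (- p)\<close> and
  \<open>sqrt (p - 1)\<close> match the weight bound. What remains for \<open>m < p\<close> is
  \<open>2 pi 2.15 ^ (p - 1) \<le> exp (3/2) 2.6 ^ (p - 1)\<close>. For \<open>m = p\<close> the left side has the additional
  factor \<open>(e w) ^ p\<close> and the right side has \<open>exp (3/4)\<close>, because only one factorial is involved.
  Both inequalities hold at \<open>p = 3\<close>, and a step in \<open>p\<close> improves them.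
\<close>

lemma ee_bound_order_ge_3:
  fixes w :: real
  assumes p: "3 \<le> p" and w: "0 < w" "w * exp (1 + w) = 1" "w \<le> 0.28"
    and lm: "1 \<le> l" "l \<le> m" "m \<le> p" and z: "z \<in> ee_stability_region p"
  shows "real m ^ p / (fact m * fact (p - m)) * cmod (1 + z / of_nat m) ^ (m - l) \<le>
    (2.6 / w) ^ p / (5.2 * pi * sqrt (real p - 1))"
proof -
  define n where "n = p - 3"
  have pn: "p = n + 3" using p by (simp add: n_def)
  define B where "B = (43 / 20 :: real) ^ (p - 1)"
  define C where "C = (2.6 :: real) ^ (p - 1)"
  have e34: "2.11 \<le> exp (3/4 :: real)"
  proof (rule power_le_imp_le_base)
    have "2.11 ^ Suc 3 \<le> (2.718 :: real) ^ 3" by (simp add: eval_nat_numeral)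
    also have "\<dots> \<le> exp 1 ^ 3"
      using e_approx_32 by (intro power_mono) (auto simp: abs_if split: if_splits)
    also have "\<dots> = exp (3/4) ^ Suc 3" by (simp only: flip: exp_of_nat_mult) simp
    finally show "2.11 ^ Suc 3 \<le> exp (3/4 :: real) ^ Suc 3" .
  qed simp
  have e32: "4.45 \<le> exp (3/2 :: real)"
    using mult_mono[OF e34 e34] by (simp flip: exp_add)
  have C: "(2.6 / w) ^ p / (5.2 * pi * sqrt (real p - 1)) = (1 / w) ^ p * C / (2 * pi * sqrt (real p - 1))"
  proof -
    have "(2.6 / w) ^ p = (1 / w) ^ p * (2.6 ^ Suc (p - 1))"
      using p by (simp add: mult.commute[of w] flip: power_mult_distrib)
    then show ?thesis by (simp add: C_def)
  qed
  have st: "cmod (1 + z / of_nat m) ^ (m - l) \<le> B"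
    unfolding B_def using assms by (intro stage_factor_le)
  show ?thesis
  proof (cases "m = p")
    case False
    have "2 * pi * B \<le> exp (3/2) * C"
    proof -
      have "2 * pi * B \<le> 6.2832 * ((43/20)\<^sup>2 * (43/20) ^ n)"
        unfolding B_def pn using pi_approx by (simp add: power_add eval_nat_numeral)
      also have "\<dots> \<le> 4.45 * (2.6\<^sup>2 * 2.6 ^ n)"
        unfolding mult.assoc[symmetric] by (rule mult_mono[OF _ power_mono]) (auto simp: power2_eq_square)
      also have "\<dots> = 4.45 * C"
        by (simp add: C_def pn power_add eval_nat_numeral)
      also have "\<dots> \<le> exp (3/2) * C"
        using e32 by (intro mult_right_mono) (auto simp: C_def)
      finally show ?thesis .
    qed
    have "real m ^ p / (fact m * fact (p - m)) * cmod (1 + z / of_nat m) ^ (m - l) \<le>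
        (1 / w) ^ p / (exp (3/2) * sqrt (real p - 1)) * B"
      using assms False st by (intro mult_mono tableau_weight_le) auto
    also have "\<dots> = (1 / w) ^ p / sqrt (real p - 1) * (B / exp (3/2))"
      by simp
    also have "\<dots> \<le> (1 / w) ^ p / sqrt (real p - 1) * (C / (2 * pi))"
      using \<open>2 * pi * B \<le> exp (3/2) * C\<close> w p
      by (intro mult_left_mono) (auto simp: divide_simps mult_ac)
    also have "\<dots> = (1 / w) ^ p * C / (2 * pi * sqrt (real p - 1))"
      by simp
    finally show ?thesis unfolding C .
  next
    case True
    have "2 * pi * ((exp 1 * w) ^ p * B) \<le> exp (3/4) * C"
    proof -
      have "exp 1 * w \<le> 2.72 * 0.28"
        using w e_less_272 by (intro mult_mono) auto
      then have "(exp 1 * w) ^ p \<le> 0.7616 ^ p"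
        using w by (intro power_mono) auto
      then have "2 * pi * ((exp 1 * w) ^ p * B) \<le> 6.2832 * (0.7616 ^ p * B)"
        using pi_approx w by (intro mult_mono) (auto simp: B_def)
      also have "\<dots> = 6.2832 * (0.7616 ^ 3 * (43/20)\<^sup>2) * (0.7616 * (43/20)) ^ n"
        unfolding B_def pn power_mult_distrib by (simp add: power_add eval_nat_numeral)
      also have "\<dots> \<le> (2.11 * 2.6\<^sup>2) * 2.6 ^ n"
        by (rule mult_mono[OF _ power_mono]) (auto simp: eval_nat_numeral)
      also have "\<dots> = 2.11 * C"
        by (simp add: C_def pn power_add eval_nat_numeral)
      also have "\<dots> \<le> exp (3/4) * C"
        using e34 by (intro mult_right_mono) (auto simp: C_def)
      finally show ?thesis .
    qed
    then have *: "exp 1 ^ p * B / exp (3/4) \<le> (1 / w) ^ p * C / (2 * pi)"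
      using w by (simp add: power_mult_distrib power_divide divide_simps mult_ac)
    have "real m ^ p / (fact m * fact (p - m)) * cmod (1 + z / of_nat m) ^ (m - l) \<le>
        exp 1 ^ p / (exp (3/4) * sqrt (real p)) * B"
      using power_over_fact_le[of p "real p"] p st True by (intro mult_mono) auto
    also have "\<dots> = (exp 1 ^ p * B / exp (3/4)) / sqrt (real p)"
      by simp
    also have "\<dots> \<le> ((1 / w) ^ p * C / (2 * pi)) / sqrt (real p - 1)"
      using * p w by (intro frac_le[OF _ *]) (auto simp: C_def)
    also have "\<dots> = (1 / w) ^ p * C / (2 * pi * sqrt (real p - 1))"
      by simp
    finally show ?thesis unfolding C .
  qed
qed

theorem theorem4p12:
  shows "(ee_max_amplification 2 (ee_stability_region 2) \<le> ereal (13 * (exp 1)\<^sup>2 / (10 * sqrt pi)) \<and>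
          13 * (exp 1)\<^sup>2 / (10 * sqrt pi) < (5.42 :: real)) \<and>
         (\<forall>p::nat. p \<ge> 3 \<longrightarrow>
           ee_max_amplification p (ee_stability_region p) \<le>
             ereal ((2.6 / lambert_W (1 / exp 1)) ^ p / (5.2 * pi * sqrt (real p - 1))) \<and>
           (2.6 / lambert_W (1 / exp 1)) ^ p / (5.2 * pi * sqrt (real p - 1)) <
             9.34 ^ p / (5.2 * pi * sqrt (real p - 1)))"
proof (intro conjI allI impI)
  have e: "2.7 \<le> exp (1::real)" "exp (1::real) \<le> 2.7183"
    using e_approx_32 by (auto simp: abs_if split: if_splits)
  have e2: "2.7\<^sup>2 \<le> (exp (1::real))\<^sup>2" "(exp (1::real))\<^sup>2 \<le> 2.7183\<^sup>2"
    using e by (intro power_mono; simp)+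
  have pi: "1.7724 \<le> sqrt pi" "sqrt pi \<le> 2"
    using pi_approx pi_less_4 by (intro real_le_rsqrt real_le_lsqrt; simp add: power2_eq_square)+
  show "13 * (exp 1)\<^sup>2 / (10 * sqrt pi) < (5.42 :: real)"
    using pi e2 by (simp add: divide_simps power2_eq_square)
  have "3 \<le> 13 * 2.7\<^sup>2 / (10 * (2::real))"
    by (simp add: power2_eq_square)
  also have "\<dots> \<le> 13 * (exp 1)\<^sup>2 / (10 * sqrt pi)"
    using pi e2 by (intro frac_le mult_left_mono) auto
  finally have three: "3 \<le> 13 * (exp 1)\<^sup>2 / (10 * sqrt pi)" .
  show "ee_max_amplification 2 (ee_stability_region 2) \<le> ereal (13 * (exp 1)\<^sup>2 / (10 * sqrt pi))"
  proof (rule ee_max_amplification_leI)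
    fix m l :: nat and z
    assume lm: "1 \<le> l" "l \<le> m" "m \<le> 2" and z: "z \<in> ee_stability_region 2"
    have "(1 + z)\<^sup>2 = 2 * (\<Sum>k=0..2. z ^ k / fact k) - 1"
      by (simp add: eval_nat_numeral field_simps)
    then have "cmod (1 + z) ^ 2 \<le> 2 * cmod (\<Sum>k=0..2. z ^ k / fact k) + 1"
      using norm_triangle_ineq4[of "2 * (\<Sum>k=0..2. z ^ k / fact k)" 1]
      by (simp add: norm_mult flip: norm_power)
    also have "\<dots> \<le> 2\<^sup>2"
      using z by (simp add: ee_stability_region_def)
    finally have "cmod (1 + z) \<le> 2"
      by (rule power2_le_imp_le) simp
    then have "cmod (2 + z) \<le> 3"
      using norm_triangle_ineq[of 1 "1 + z"] by (simp add: add.assoc[symmetric])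
    moreover have "2 * cmod (1 + z / 2) = cmod (2 + z)"
      using norm_mult[of 2 "1 + z / 2"] by (simp add: algebra_simps)
    moreover have "m = 1 \<and> l = 1 \<or> m = 2 \<and> l = 1 \<or> m = 2 \<and> l = 2"
      using lm by auto
    ultimately have "real m ^ 2 / (fact m * fact (2 - m)) * cmod (1 + z / of_nat m) ^ (m - l) \<le> 3"
      by auto
    then show "real m ^ 2 / (fact m * fact (2 - m)) * cmod (1 + z / of_nat m) ^ (m - l) \<le>
        13 * (exp 1)\<^sup>2 / (10 * sqrt pi)"
      using three by linarith
  qed simp
next
  fix p :: nat
  assume p: "3 \<le> p"
  then show "ee_max_amplification p (ee_stability_region p) \<le>
      ereal ((2.6 / lambert_W (1 / exp 1)) ^ p / (5.2 * pi * sqrt (real p - 1)))"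
    using lambert_W_inverse_e by (intro ee_max_amplification_leI ee_bound_order_ge_3) auto
  have "2.6 / lambert_W (1 / exp 1) < 9.34"
    using lambert_W_inverse_e(1,3) by (simp add: field_simps)
  then have "(2.6 / lambert_W (1 / exp 1)) ^ p < 9.34 ^ p"
    using p lambert_W_inverse_e(1) by (intro power_strict_mono) auto
  then show "(2.6 / lambert_W (1 / exp 1)) ^ p / (5.2 * pi * sqrt (real p - 1)) <
      9.34 ^ p / (5.2 * pi * sqrt (real p - 1))"
    using p by (intro divide_strict_right_mono) auto
qed

end
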